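(* Let $G=(V,E)$ be a connected undirected graph with $V=\{1,\ldots,n\}$. Run depth-first search (DFS) on $G$ and let $v_1,\ldots,v_n$ be the nodes in the order in which they are first reached by DFS. Let $\tau:\{1,\ldots,n\}\to\{1,\ldots,n\}$ be the bijection $\tau(i)=v_i$, and let $P\in\mathbb{R}^{n\times n}$ be the associated permutation matrix, $(P\theta)_i=\theta_{\tau(i)}$. Then $$\|\nabla_{\mathrm{1d}}P\theta\|_1\le 2\|\nabla_G\theta\|_1\quad\text{for all }\theta\in\mathbb{R}^n,$$ and $$\|\nabla_{\mathrm{1d}}P\theta\|_0\le 2\|\nabla_G\theta\|_0\quad\text{for all }\theta\in\mathbb{R}^n.$$
   Context: Graphs are finite and undirected. For each edge $e\in E$ fix an arbitrary orientation, with head $e^+$ and tail $e^-$. The edge incidence matrix $\nabla_G\in\mathbb{R}^{|E|\times n}$ has row $e$ with entry $1$ in column $e^+$, $-1$ in column $e^-$, and $0$ elsewhere, so that $\|\nabla_G\theta\|_1=\sum_{e\in E}|\theta_{e^+}-\theta_{e^-}|$ and $\|\nabla_G\theta\|_0=\sum_{e\in E}1\{\theta_{e^+}\ne\theta_{e^-}\}$ (neither depends on the orientation). $\nabla_{\mathrm{1d}}\in\mathbb{R}^{(n-1)\times n}$ is the edge incidence matrix of the chain $1-2-\cdots-n$: $(\nabla_{\mathrm{1d}}x)_i=x_{i+1}-x_i$, $i=1,\ldots,n-1$. Hence $\|\nabla_{\mathrm{1d}}P\theta\|_1=\sum_{i=1}^{n-1}|\theta_{\tau(i+1)}-\theta_{\tau(i)}|$,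 and $\|\nabla_{\mathrm{1d}}P\theta\|_0$ is the number of $i\in\{1,\ldots,n-1\}$ with $\theta_{\tau(i+1)}\neq\theta_{\tau(i)}$. DFS is the standard algorithm: start at an arbitrary node; from the current node move to an arbitrary unvisited neighbor if one exists, and otherwise backtrack to the node from which the current node was first reached; continue until all nodes are visited. *)

theory Defs
  imports Complex_Main
begin

definition simple_graph :: "'v set \<Rightarrow> 'v set set \<Rightarrow> bool" where
  "simple_graph V E \<longleftrightarrow> finite V \<and> (\<forall>e\<in>E. e \<subseteq> V \<and> card e = 2)"

definition graph_connected :: "'v set \<Rightarrow> 'v set set \<Rightarrow> bool" where
  "graph_connected V E \<longleftrightarrow> (\<forall>u\<in>V. \<forall>v\<in>V. (\<lambda>x y. {x, y} \<in> E)\<^sup>*\<^sup>* u v)"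

(* In a simple graph this forces head e and tail e to be distinct, since card e = 2. *)
definition orientation :: "'v set set \<Rightarrow> ('v set \<Rightarrow> 'v) \<Rightarrow> ('v set \<Rightarrow> 'v) \<Rightarrow> bool" where
  "orientation E head tail \<longleftrightarrow> (\<forall>e\<in>E. e = {head e, tail e})"


(* A vector is a function and a matrix is a binary function (row, column). The finite index
   sets are passed explicitly to the operations below, so that the rows of an incidence
   matrix can be indexed by the edges themselves. *)

definition mat_vec :: "'c set \<Rightarrow> ('r \<Rightarrow> 'c \<Rightarrow> real) \<Rightarrow> ('c \<Rightarrow> real) \<Rightarrow> 'r \<Rightarrow> real" where
  "mat_vec C A x = (\<lambda>r. \<Sum>c\<in>C. A r c * x c)"

definition l1_norm :: "'r set \<Rightarrow> ('r \<Rightarrow> real) \<Rightarrow> real" where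
  "l1_norm R y = (\<Sum>r\<in>R. \<bar>y r\<bar>)"

definition l0_norm :: "'r set \<Rightarrow> ('r \<Rightarrow> real) \<Rightarrow> nat" where
  "l0_norm R y = card {r \<in> R. y r \<noteq> 0}"

definition incidence_matrix :: "('e \<Rightarrow> 'v) \<Rightarrow> ('e \<Rightarrow> 'v) \<Rightarrow> 'e \<Rightarrow> 'v \<Rightarrow> real" where
  "incidence_matrix head tail e v = (if v = head e then 1 else if v = tail e then - 1 else 0)"

(* Row i (1 \<le> i \<le> n - 1) is the edge between i and i + 1, oriented towards i + 1. *)
definition chain_matrix :: "nat \<Rightarrow> nat \<Rightarrow> real" where
  "chain_matrix = incidence_matrix Suc (\<lambda>i. i)"

definition perm_matrix :: "(nat \<Rightarrow> nat) \<Rightarrow> nat \<Rightarrow> nat \<Rightarrow> real" where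
  "perm_matrix \<tau> i j = (if j = \<tau> i then 1 else 0)"


(* A state (u, par, vs) consists of the current node u, the map par sending every visited node
   other than the root to the node from which it was first reached, and the list vs of visited
   nodes in the order of their first visit. *)
inductive dfs_step ::
  "'v set set \<Rightarrow> 'v \<times> ('v \<rightharpoonup> 'v) \<times> 'v list \<Rightarrow> 'v \<times> ('v \<rightharpoonup> 'v) \<times> 'v list \<Rightarrow> bool"
  for E where
  advance: "\<lbrakk>{u, w} \<in> E; w \<notin> set vs\<rbrakk>
    \<Longrightarrow> dfs_step E (u, par, vs) (w, par(w \<mapsto> u), vs @ [w])"
| backtrack: "\<lbrakk>\<forall>w. {u, w} \<in> E \<longrightarrow> w \<in> set vs; par u = Some p\<rbrakk>
    \<Longrightarrow> dfs_step E (u, par, vs) (p, par, vs)"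

definition dfs_order :: "'v set \<Rightarrow> 'v set set \<Rightarrow> 'v list \<Rightarrow> bool" where
  "dfs_order V E vs \<longleftrightarrow>
     (\<exists>r\<in>V. \<exists>u par. (dfs_step E)\<^sup>*\<^sup>* (r, Map.empty, [r]) (u, par, vs) \<and> set vs = V)"

lemma dfs_order_distinct:
  assumes "dfs_order V E vs"
  shows "distinct vs"
proof -
  have "distinct (snd (snd s))" if "(dfs_step E)\<^sup>*\<^sup>* (r, Map.empty, [r]) s" for r s
    using that by (induction rule: rtranclp_induct) (auto elim!: dfs_step.cases)
  then show ?thesis
    using assms by (fastforce simp: dfs_order_def)
qed

lemma dfs_order_bij_betw:
  assumes "dfs_order {1..n} E vs" "\<And>i. i \<in> {1..n} \<Longrightarrow> \<tau> i = vs ! (i - 1)"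
  shows "bij_betw \<tau> {1..n} {1..n}"
proof -
  have d: "distinct vs"
    using assms(1) by (rule dfs_order_distinct)
  have s: "set vs = {1..n}"
    using assms(1) unfolding dfs_order_def by blast
  then have l: "length vs = n"
    using distinct_card[OF d] by simp
  have "bij_betw (\<lambda>i. i - 1) {1..n} {..<n}"
    by (rule bij_betw_byWitness[where f' = Suc]) auto
  moreover have "bij_betw ((!) vs) {..<n} {1..n}"
    using bij_betw_nth[OF d] l s by auto
  ultimately have "bij_betw ((!) vs \<circ> (\<lambda>i. i - 1)) {1..n} {1..n}"
    by (rule bij_betw_trans)
  then show ?thesis
    using bij_betw_cong[of "{1..n}" \<tau> "(!) vs \<circ> (\<lambda>i. i - 1)"] assms(2) by auto
qed

lemma mat_vec_incidence:
  assumes "finite C" "head e \<in> C" "tail e \<in> C" "head e \<noteq> tail e"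
  shows "mat_vec C (incidence_matrix head tail) x e = x (head e) - x (tail e)"
proof -
  have "mat_vec C (incidence_matrix head tail) x e =
      (\<Sum>c\<in>C. (if c = head e then x c else 0) - (if c = tail e then x c else 0))"
    unfolding mat_vec_def incidence_matrix_def using assms(4) by (intro sum.cong) auto
  then show ?thesis
    using assms by (simp add: sum_subtractf)
qed

lemma mat_vec_chain:
  assumes "i \<in> {1..n - 1}"
  shows "mat_vec {1..n} chain_matrix x i = x (i + 1) - x i"
  using assms by (auto simp: chain_matrix_def mat_vec_incidence)

lemma mat_vec_perm:
  assumes "finite C" "\<tau> i \<in> C"
  shows "mat_vec C (perm_matrix \<tau>) x i = x (\<tau> i)"
  using assms by (simp add: mat_vec_def perm_matrix_def if_distrib[of "\<lambda>a. a * _"] cong: if_cong)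

end

theory Submission
  imports Defs
begin

text \<open>Both norms are total edge lengths for a pseudometric \<open>d\<close> on the vertices, namely
  \<open>\<bar>\<theta> x - \<theta> y\<bar>\<close> and \<open>1{\<theta> x \<noteq> \<theta> y}\<close>.  The DFS walk from the first to the last new vertex traverses every
  tree edge at most twice, so by the triangle inequality the visiting order has \<open>d\<close>-length at most
  twice that of the tree.  As a potential argument: if \<open>h\<close> is the \<open>d\<close>-distance to the root along the
  tree, then (length of the visiting order) + \<open>d (last vs) u + h u\<close> never exceeds twice the length of
  the current tree, \<open>u\<close> being the current node.\<close>

locale pseudometric =
  fixes d :: "'v \<Rightarrow> 'v \<Rightarrow> real"
  assumes nonneg: "0 \<le> d x y"
    and d_refl: "d x x = 0"
    and d_sym: "d x y = d y x"
    and triangle: "d x z \<le> d x y + d y z"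
begin

definition path_length :: "'v list \<Rightarrow> real" where
  "path_length vs = (\<Sum>i<length vs - 1. d (vs ! i) (vs ! Suc i))"

lemma path_length_append_single:
  assumes "vs \<noteq> []"
  shows "path_length (vs @ [w]) = path_length vs + d (last vs) w"
proof -
  obtain m where m: "length vs = Suc m"
    using assms by (cases vs) auto
  have "(\<Sum>i<m. d ((vs @ [w]) ! i) ((vs @ [w]) ! Suc i)) = (\<Sum>i<m. d (vs ! i) (vs ! Suc i))"
    using m by (intro sum.cong) (auto simp: nth_append)
  moreover have "last vs = vs ! m"
    using assms m by (simp add: last_conv_nth)
  ultimately show ?thesis
    using m by (simp add: path_length_def nth_append)
qed

text \<open>\<open>F\<close> collects the tree edges and \<open>h\<close> is the distance to the root along the tree.\<close>

definition dfs_invariant ::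
  "'v set set \<Rightarrow> ('v set \<Rightarrow> real) \<Rightarrow> 'v \<times> ('v \<rightharpoonup> 'v) \<times> 'v list \<Rightarrow> bool" where
  "dfs_invariant E len s \<longleftrightarrow> (case s of (u, par, vs) \<Rightarrow>
     u \<in> set vs \<and>
     (\<forall>x p. par x = Some p \<longrightarrow> x \<in> set vs \<and> p \<in> set vs) \<and>
     (\<exists>F h. F \<subseteq> E \<and> \<Union>F \<subseteq> set vs \<and> (\<forall>x. 0 \<le> h x) \<and>
        (\<forall>x p. par x = Some p \<longrightarrow> h x = h p + d p x) \<and>
        path_length vs + d (last vs) u + h u \<le> 2 * sum len F))"

text \<open>Advancing from \<open>u\<close> to \<open>w\<close> adds
  \<open>d (last vs) w \<le> d (last vs) u + d u w\<close> to the path, resets the middle term to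
  \<open>0\<close> and raises the \<open>h\<close> term by \<open>d u w\<close>: in total at most
  twice the new edge. Backtracking to \<open>p\<close> lowers the \<open>h\<close> term by
  \<open>d p u\<close>, which covers the growth of the middle term to
  \<open>d (last vs) p\<close>.\<close>

lemma dfs_invariant_step:
  assumes step: "dfs_step E s t"
    and inv: "dfs_invariant E len s"
    and "finite E"
    and len: "\<And>x y. {x, y} \<in> E \<Longrightarrow> len {x, y} = d x y"
  shows "dfs_invariant E len t"
  using step
proof cases
  case (advance u w vs par)
  obtain F h where u: "u \<in> set vs"
    and par: "\<And>x p. par x = Some p \<Longrightarrow> x \<in> set vs \<and> p \<in> set vs"
    and F: "F \<subseteq> E" "\<Union>F \<subseteq> set vs"
    and h: "\<And>x. 0 \<le> h x" "\<And>x p. par x = Some p \<Longrightarrow> h x = h p + d p x"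
    and le: "path_length vs + d (last vs) u + h u \<le> 2 * sum len F"
    using inv unfolding dfs_invariant_def advance(1) prod.case by blast
  define h' where "h' = h(w := h u + d u w)"
  \<comment> \<open>The clause \<open>\<Union>F \<subseteq> set vs\<close> of the invariant serves
    here: an edge at the unvisited \<open>w\<close> is new to \<open>F\<close>, so the sum gains
    exactly \<open>d u w\<close>.\<close>
  have "{u, w} \<notin> F"
    using F(2) advance by auto
  then have sum: "sum len (insert {u, w} F) = d u w + sum len F"
    using finite_subset[OF F(1) \<open>finite E\<close>] len[of u w] advance by simp
  have "vs \<noteq> []"
    using u by auto
  then have "path_length (vs @ [w]) + d (last (vs @ [w])) w + h' w
      \<le> 2 * sum len (insert {u, w} F)"
    using le triangle[of "last vs" w u]
    by (simp add: sum h'_def d_refl path_length_append_single)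
  \<comment> \<open>Altering \<open>h\<close> at \<open>w\<close> breaks no earlier equation, since
    all recorded children and parents lie in \<open>set vs\<close>.\<close>
  moreover have "h' x = h' p + d p x" if "(par(w \<mapsto> u)) x = Some p" for x p
    using that u par[of x p] h(2)[of x p] advance by (auto simp: h'_def split: if_splits)
  moreover have "0 \<le> h' x" for x
    using h(1) nonneg by (simp add: h'_def)
  moreover have "insert {u, w} F \<subseteq> E" "\<Union>(insert {u, w} F) \<subseteq> set (vs @ [w])"
    using F u advance by auto
  moreover have "x \<in> set (vs @ [w]) \<and> p \<in> set (vs @ [w])" if "(par(w \<mapsto> u)) x = Some p" for x p
    using that par[of x p] u by (auto split: if_splits)
  ultimately show ?thesis
    unfolding dfs_invariant_def advance(2) prod.case
    by (intro conjI exI[of _ "insert {u, w} F"] exI[of _ h']) auto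
next
  case (backtrack u vs par p)
  obtain F h where par: "\<And>x p. par x = Some p \<Longrightarrow> x \<in> set vs \<and> p \<in> set vs"
    and F: "F \<subseteq> E" "\<Union>F \<subseteq> set vs"
    and h: "\<And>x. 0 \<le> h x" "\<And>x p. par x = Some p \<Longrightarrow> h x = h p + d p x"
    and le: "path_length vs + d (last vs) u + h u \<le> 2 * sum len F"
    using inv unfolding dfs_invariant_def backtrack(1) prod.case by blast
  have "path_length vs + d (last vs) p + h p \<le> 2 * sum len F"
    using le h(2)[OF backtrack(4)] triangle[of "last vs" p u] d_sym[of u p] by simp
  then show ?thesis
    unfolding dfs_invariant_def backtrack(2) prod.case
    using par F h backtrack(4) by blast
qed

lemma dfs_order_path_length_le:
  assumes "dfs_order V E vs"
    and "finite E"
    and len: "\<And>x y. {x, y} \<in> E \<Longrightarrow> len {x, y} = d x y"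
    and len_nonneg: "\<And>e. e \<in> E \<Longrightarrow> 0 \<le> len e"
  shows "path_length vs \<le> 2 * sum len E"
proof -
  obtain r u par where run: "(dfs_step E)\<^sup>*\<^sup>* (r, Map.empty, [r]) (u, par, vs)"
    using assms(1) by (auto simp: dfs_order_def)
  have init: "dfs_invariant E len (r, Map.empty, [r])"
    \<comment> \<open>The tree starts without edges and the potential at \<open>0\<close>.\<close>
    by (auto simp: dfs_invariant_def path_length_def d_refl
        intro!: exI[of _ "{}"] exI[of _ "\<lambda>_. 0"])
  from run have "dfs_invariant E len (u, par, vs)"
    by (induction rule: rtranclp_induct)
      (use init assms(2) len in \<open>auto intro: dfs_invariant_step\<close>)
  then obtain F h where F: "F \<subseteq> E" and h: "0 \<le> h u"
    and le: "path_length vs + d (last vs) u + h u \<le> 2 * sum len F"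
    unfolding dfs_invariant_def prod.case by blast
  have "sum len F \<le> sum len E"
    using F assms(2) len_nonneg by (intro sum_mono2) auto
  then show ?thesis
    using le h nonneg[of "last vs" u] by linarith
qed

text \<open>Common form of both inequalities: the choice of \<open>d\<close> decides the
  norm.\<close>

lemma dfs_order_chain_le:
  assumes "dfs_order V E vs" "card V = n" "finite E" "orientation E head tail"
    and \<tau>: "\<And>i. i \<in> {1..n} \<Longrightarrow> \<tau> i = vs ! (i - 1)"
  shows "(\<Sum>i\<in>{1..n - 1}. d (\<tau> (i + 1)) (\<tau> i)) \<le> 2 * (\<Sum>e\<in>E. d (head e) (tail e))"
proof -
  have len: "d (head {x, y}) (tail {x, y}) = d x y" if "{x, y} \<in> E" for x y
  proof -
    \<comment> \<open>Fresh names, since the equation for \<open>{x, y}\<close> below repeats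
      \<open>{x, y}\<close> on its right-hand side and would loop as a rewrite rule.\<close>
    obtain a b where ab: "head {x, y} = a" "tail {x, y} = b"
      by blast
    have "{x, y} = {head {x, y}, tail {x, y}}"
      using bspec[OF assms(4)[unfolded orientation_def] that] .
    then have "{x, y} = {a, b}"
      unfolding ab .
    then show ?thesis
      unfolding ab by (auto simp: doubleton_eq_iff d_sym)
  qed
  have "length vs = n"
    using distinct_card[OF dfs_order_distinct[OF assms(1)]] assms(1,2)
    by (simp add: dfs_order_def)
  then have "path_length vs = (\<Sum>i\<in>{1..n - 1}. d (\<tau> (i + 1)) (\<tau> i))"
    unfolding path_length_def
    \<comment> \<open>Lists count from \<open>0\<close> and \<open>\<tau>\<close> from
      \<open>1\<close>, hence the shift by \<open>Suc\<close>; \<open>d_sym\<close> turns each path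
      step around to match head \<open>i + 1\<close> and tail \<open>i\<close> of the chain.\<close>
    by (intro sum.reindex_bij_witness[of _ "\<lambda>i. i - 1" Suc]) (auto simp: \<tau> d_sym)
  moreover have "path_length vs \<le> 2 * (\<Sum>e\<in>E. d (head e) (tail e))"
    by (rule dfs_order_path_length_le[OF assms(1,3)]) (auto simp: len nonneg)
  ultimately show ?thesis
    by simp
qed

end

theorem lemma1:
  fixes n :: nat
    and E :: "nat set set"
    and head tail :: "nat set \<Rightarrow> nat"
    and vs :: "nat list"
    and \<tau> :: "nat \<Rightarrow> nat"
  assumes "simple_graph {1..n} E"
    and "graph_connected {1..n} E"
    and "orientation E head tail"
    and "dfs_order {1..n} E vs"
    and "\<And>i. i \<in> {1..n} \<Longrightarrow> \<tau> i = vs ! (i - 1)"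
  shows "(\<forall>\<theta> :: nat \<Rightarrow> real.
            l1_norm {1..n - 1} (mat_vec {1..n} chain_matrix (mat_vec {1..n} (perm_matrix \<tau>) \<theta>))
            \<le> 2 * l1_norm E (mat_vec {1..n} (incidence_matrix head tail) \<theta>)) \<and>
         (\<forall>\<theta> :: nat \<Rightarrow> real.
            l0_norm {1..n - 1} (mat_vec {1..n} chain_matrix (mat_vec {1..n} (perm_matrix \<tau>) \<theta>))
            \<le> 2 * l0_norm E (mat_vec {1..n} (incidence_matrix head tail) \<theta>))"
proof -
  have fin: "finite E"
    using assms(1) by (intro finite_subset[of E "Pow {1..n}"]) (auto simp: simple_graph_def)
  have card: "card {1..n} = n"
    by simp
  have chain: "mat_vec {1..n} chain_matrix (mat_vec {1..n} (perm_matrix \<tau>) \<theta>) i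
      = \<theta> (\<tau> (i + 1)) - \<theta> (\<tau> i)" if "i \<in> {1..n - 1}" for \<theta> i
  proof -
    have "i \<in> {1..n}" "i + 1 \<in> {1..n}"
      using that by auto
    then have "\<tau> i \<in> {1..n}" "\<tau> (i + 1) \<in> {1..n}"
      using bij_betwE[OF dfs_order_bij_betw[OF assms(4,5)]] by blast+
    then show ?thesis
      using that by (simp only: mat_vec_chain mat_vec_perm finite_atLeastAtMost)
  qed
  have edge: "mat_vec {1..n} (incidence_matrix head tail) \<theta> e = \<theta> (head e) - \<theta> (tail e)"
    if "e \<in> E" for \<theta> e
  proof -
    obtain x y where xy: "head e = x" "tail e = y"
      by blast
    have "e = {head e, tail e}"
      using that assms(3) unfolding orientation_def by blast
    then have "e = {x, y}"
      unfolding xy .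
    moreover have "e \<subseteq> {1..n}" "card e = 2"
      using that assms(1) unfolding simple_graph_def by blast+
    ultimately have "x \<in> {1..n}" "y \<in> {1..n}" "x \<noteq> y"
      by (auto simp: card_insert_if split: if_splits)
    then show ?thesis
      by (simp add: mat_vec_incidence xy)
  qed
  \<comment> \<open>Turns the counts in \<open>l0_norm\<close> into real sums of indicators, the
    form that a real-valued \<open>d\<close> yields.\<close>
  have card_eq: "real (card {i \<in> I. P i}) = (\<Sum>i\<in>I. of_bool (P i))"
    if "finite I" for I :: "'i set" and P
    using sum.inter_filter[OF that, of "\<lambda>_. 1 :: real" P] by (simp add: of_bool_def)
  show ?thesis
  proof (intro conjI allI)
    fix \<theta> :: "nat \<Rightarrow> real"
    interpret pseudometric "\<lambda>x y. \<bar>\<theta> x - \<theta> y\<bar>"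
      by unfold_locales auto
    show "l1_norm {1..n - 1} (mat_vec {1..n} chain_matrix (mat_vec {1..n} (perm_matrix \<tau>) \<theta>))
        \<le> 2 * l1_norm E (mat_vec {1..n} (incidence_matrix head tail) \<theta>)"
      using dfs_order_chain_le[OF assms(4) card fin assms(3,5)]
      by (simp add: l1_norm_def chain edge del: One_nat_def)
  next
    fix \<theta> :: "nat \<Rightarrow> real"
    \<comment> \<open>The discrete metric pulled back along \<open>\<theta>\<close>: if
      \<open>\<theta> x \<noteq> \<theta> z\<close>, then \<open>\<theta> y\<close> differs from one
      of the two, which is the triangle inequality.\<close>
    interpret pseudometric "\<lambda>x y. of_bool (\<theta> x \<noteq> \<theta> y)"
      by unfold_locales auto
    let ?c = "mat_vec {1..n} chain_matrix (mat_vec {1..n} (perm_matrix \<tau>) \<theta>)"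
    let ?e = "mat_vec {1..n} (incidence_matrix head tail) \<theta>"
    have "real (l0_norm {1..n - 1} ?c) = (\<Sum>i\<in>{1..n - 1}. of_bool (\<theta> (\<tau> (i + 1)) \<noteq> \<theta> (\<tau> i)))"
      unfolding l0_norm_def card_eq[OF finite_atLeastAtMost]
      by (intro sum.cong refl arg_cong[where f = of_bool]) (simp only: chain, simp)
    moreover have "real (l0_norm E ?e) = (\<Sum>e\<in>E. of_bool (\<theta> (head e) \<noteq> \<theta> (tail e)))"
      unfolding l0_norm_def card_eq[OF fin]
      by (intro sum.cong refl arg_cong[where f = of_bool]) (simp only: edge, simp)
    ultimately have "real (l0_norm {1..n - 1} ?c) \<le> 2 * real (l0_norm E ?e)"
      using dfs_order_chain_le[OF assms(4) card fin assms(3,5)] by simp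
    then show "l0_norm {1..n - 1} ?c \<le> 2 * l0_norm E ?e"
      by linarith
  qed
qed

end
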